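(* Let $G$ be a connected graph of order $n \ge 3$ with diameter at most $2$. Then $\gamma_{\rm it}^{\rm g}(G) \le \frac{2}{3}n$ and $\gamma_{\rm it}^{\rm g\prime}(G) \le \frac{2}{3}n$.
   Context: All graphs are finite and simple. For a vertex set $S$, $N_G(S)$ denotes the set of vertices adjacent to at least one vertex of $S$, and $G - X$ is the graph obtained by deleting the vertices of $X$. The total isolation game on a graph $G$ is played by two players, Dominator and Staller, who alternately select vertices of $G$. If $S$ is the set of vertices selected so far, a vertex $v$ may be selected only if $v$ is adjacent to some vertex $u$ such that either $u$ belongs to a component of $G - N_G(S)$ of order at least $2$, or $u \in S$ and $u$ is an isolated vertex of $G - N_G(S)$. The game ends when no such vertex exists. Dominator aims to minimize the total number of selected vertices, Staller aims to maximize it. $\gamma_{\rm it}^{\rm g}(G)$ (resp. $\gamma_{\rm it}^{\rm g\prime}(G)$) is the number of moves in the game in which Dominator (resp. Staller) makes the first move and both players play optimally. *)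

theory Defs
  imports "Graph_Theory.Graph_Theory"
begin

text \<open>
  Finite simple graphs are those \<open>G\<close> satisfying the library locale predicate \<open>graph\<close>:
  finite, loop-free, without parallel arcs, and with a symmetric adjacency relation
  \<open>u \<rightarrow>\<^bsub>G\<^esub> v\<close>.
\<close>

definition diameter :: "('a, 'b) pre_digraph \<Rightarrow> ereal" where
  "diameter G = (SUP u \<in> verts G. SUP v \<in> verts G. wf_digraph.\<mu> G (\<lambda>_. 1) u v)"

definition neighborhood :: "('a, 'b) pre_digraph \<Rightarrow> 'a set \<Rightarrow> 'a set" where
  "neighborhood G S = {v \<in> verts G. \<exists>u \<in> S. u \<rightarrow>\<^bsub>G\<^esub> v}"

definition delete_verts :: "('a, 'b) pre_digraph \<Rightarrow> 'a set \<Rightarrow> ('a, 'b) pre_digraph" where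
  "delete_verts G X = G \<restriction> (verts G - X)"

definition isolated_vertex :: "('a, 'b) pre_digraph \<Rightarrow> 'a \<Rightarrow> bool" where
  "isolated_vertex G u \<longleftrightarrow> u \<in> verts G \<and> (\<forall>w. \<not> u \<rightarrow>\<^bsub>G\<^esub> w)"

text \<open>
  In a symmetric digraph the strong components, whose vertex sets form \<open>sccs_verts\<close>, are
  the components of the graph. A vertex that has already been selected is never playable
  (see \<open>playable_not_selected\<close>), so this need not be required separately.
\<close>

definition playable :: "('a, 'b) pre_digraph \<Rightarrow> 'a set \<Rightarrow> 'a set" where
  "playable G S =
     {v \<in> verts G. \<exists>u. v \<rightarrow>\<^bsub>G\<^esub> u \<and>
        ((\<exists>C \<in> pre_digraph.sccs_verts (delete_verts G (neighborhood G S)). u \<in> C \<and> 2 \<le> card C) \<or>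
         (u \<in> S \<and> isolated_vertex (delete_verts G (neighborhood G S)) u))}"

lemma playable_not_selected:
  assumes "v \<in> playable G S"
  shows "v \<notin> S"
proof
  assume "v \<in> S"
  from assms obtain u where vu: "v \<rightarrow>\<^bsub>G\<^esub> u"
    and u: "(\<exists>C \<in> pre_digraph.sccs_verts (delete_verts G (neighborhood G S)). u \<in> C) \<or>
       isolated_vertex (delete_verts G (neighborhood G S)) u"
    unfolding playable_def by blast
  from u have "u \<in> verts (delete_verts G (neighborhood G S))"
    unfolding isolated_vertex_def pre_digraph.sccs_verts_def reachable_def
    by (auto dest: in_rtrancl_on_in_F)
  then have "u \<in> verts G" "u \<notin> neighborhood G S"
    by (auto simp: delete_verts_def)
  with vu \<open>v \<in> S\<close> show False
    unfolding neighborhood_def by blast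
qed

datatype player = Dominator | Staller

text \<open>
  \<open>remaining_moves G p S\<close> is the number of moves still to be made under optimal play when
  the vertices of \<open>S\<close> have been selected and it is the turn of \<open>p\<close>. The finiteness test
  only serves termination; it holds for every graph.
\<close>

function remaining_moves :: "('a, 'b) pre_digraph \<Rightarrow> player \<Rightarrow> 'a set \<Rightarrow> nat" where
  "remaining_moves G Dominator S =
     (if finite (verts G) \<and> playable G S \<noteq> {}
      then 1 + Min ((\<lambda>v. remaining_moves G Staller (insert v S)) ` playable G S) else 0)"
| "remaining_moves G Staller S =
     (if finite (verts G) \<and> playable G S \<noteq> {}
      then 1 + Max ((\<lambda>v. remaining_moves G Dominator (insert v S)) ` playable G S) else 0)"
  by pat_completeness auto

lemma card_unselected_less:
  assumes "finite (verts G)" "v \<in> playable G S"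
  shows "card (verts G - insert v S) < card (verts G - S)"
proof (rule psubset_card_mono)
  show "verts G - insert v S \<subset> verts G - S"
    using assms(2) playable_not_selected[OF assms(2)] by (auto simp: playable_def)
qed (use assms(1) in simp)

termination remaining_moves
  by (relation "measure (\<lambda>(G, p, S). card (verts G - S))") (auto simp: card_unselected_less)

declare remaining_moves.simps [simp del]

definition D_game_total_isolation_number :: "('a, 'b) pre_digraph \<Rightarrow> nat" where
  "D_game_total_isolation_number G = remaining_moves G Dominator {}"

definition S_game_total_isolation_number :: "('a, 'b) pre_digraph \<Rightarrow> nat" where
  "S_game_total_isolation_number G = remaining_moves G Staller {}"

end

theory Submission
  imports Defs
begin

text \<open>
  Call a vertex outside \<open>N(S)\<close> active if it lies in \<open>S\<close> or has a neighbour outside \<open>N(S)\<close>; the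
  playable vertices are the neighbours of active ones. Active vertices are never created, and
  every move removes one. If the distances are at most 2, Dominator can always remove two, unless
  only one is left: he plays a vertex with two neighbours outside \<open>N(S)\<close>; or, if the edges
  outside \<open>N(S)\<close> form a matching, a dominated neighbour of an end of one of them, which makes the
  other end isolated; or, if there is no such edge, a common neighbour of two active vertices.
  With \<open>m\<close> active vertices this leaves at most \<open>(2 m + 1) / 3\<close> moves on Dominator's turn and at
  most \<open>(2 m + 2) / 3\<close> on Staller's. The additive constants are absorbed by the first
  move, which removes more vertices outside some small cases.
\<close>

section \<open>Active vertices and playability\<close>

definition active :: "('a, 'b) pre_digraph \<Rightarrow> 'a set \<Rightarrow> 'a set" where
  "active G S = {u \<in> verts G - neighborhood G S.
     u \<in> S \<or> (\<exists>w \<in> verts G - neighborhood G S. u \<rightarrow>\<^bsub>G\<^esub> w)}"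

lemma active_subset: "active G S \<subseteq> verts G - neighborhood G S"
  by (auto simp: active_def)

lemma (in graph) adj_sym: "u \<rightarrow>\<^bsub>G\<^esub> v \<Longrightarrow> v \<rightarrow>\<^bsub>G\<^esub> u"
  using arcs_ends_symmetric[OF sym_arcs] .

lemma (in graph) dominates_delete_verts:
  "u \<rightarrow>\<^bsub>delete_verts G X\<^esub> v \<longleftrightarrow> u \<rightarrow>\<^bsub>G\<^esub> v \<and> u \<notin> X \<and> v \<notin> X"
  by (auto simp: delete_verts_def induce_subgraph_def arcs_ends_conv)

text \<open>A path from \<open>u\<close> to a second vertex of its component begins with an arc at
  \<open>u\<close>; conversely, by symmetry, the two ends of an arc share a strong
  component.\<close>

lemma (in graph) in_nontrivial_component_iff:
  "(\<exists>C \<in> pre_digraph.sccs_verts (delete_verts G X). u \<in> C \<and> 2 \<le> card C) \<longleftrightarrow>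
     (\<exists>w. u \<rightarrow>\<^bsub>delete_verts G X\<^esub> w)"
proof -
  let ?H = "delete_verts G X"
  interpret H: wf_digraph ?H
    unfolding delete_verts_def by (rule wellformed_induce_subgraph)
  have fin: "finite (verts ?H)" by (simp add: delete_verts_def)
  show ?thesis
  proof
    assume "\<exists>C \<in> H.sccs_verts. u \<in> C \<and> 2 \<le> card C"
    then obtain C where C: "C \<in> H.sccs_verts" "u \<in> C" "2 \<le> card C" by blast
    have "C \<noteq> {u}" using C(3) by auto
    then obtain w where w: "w \<in> C" "w \<noteq> u" using C(2) by blast
    have "u \<rightarrow>\<^sup>*\<^bsub>?H\<^esub> w" using C w by (auto simp: H.in_sccs_verts_conv_reachable)
    then show "\<exists>w. u \<rightarrow>\<^bsub>?H\<^esub> w"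
      by (cases rule: H.converse_reachable_cases) (use w in auto)
  next
    assume "\<exists>w. u \<rightarrow>\<^bsub>?H\<^esub> w"
    then obtain w where uw: "u \<rightarrow>\<^bsub>?H\<^esub> w" by blast
    then have wu: "w \<rightarrow>\<^bsub>?H\<^esub> u" and "u \<noteq> w"
      using adj_sym adj_not_same by (auto simp: dominates_delete_verts)
    have "{u, w} \<subseteq> H.scc_of u"
      using uw wu by (auto simp: H.scc_of_def dest: H.adj_in_verts)
    moreover have "H.scc_of u \<in> H.sccs_verts"
      using uw by (intro H.scc_of_in_sccs_verts H.adj_in_verts)
    \<comment> \<open>Finiteness matters because \<open>card\<close> of an infinite set is
      0.\<close>
    moreover from this have "finite (H.scc_of u)"
      using H.sccs_verts_subsets fin finite_subset by blast
    ultimately show "\<exists>C \<in> H.sccs_verts. u \<in> C \<and> 2 \<le> card C"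
      using card_mono[of "H.scc_of u" "{u, w}"] \<open>u \<noteq> w\<close> by auto
  qed
qed

lemma (in graph) playable_iff_active:
  "v \<in> playable G S \<longleftrightarrow> (\<exists>u \<in> active G S. v \<rightarrow>\<^bsub>G\<^esub> u)"
proof -
  \<comment> \<open>A selected vertex outside N(S) either keeps a neighbour or is isolated, so the
    two alternatives together cover all of \<open>S\<close> outside N(S).\<close>
  have "(\<exists>w. u \<rightarrow>\<^bsub>delete_verts G (neighborhood G S)\<^esub> w) \<or>
      (u \<in> S \<and> isolated_vertex (delete_verts G (neighborhood G S)) u) \<longleftrightarrow> u \<in> active G S"
    if "u \<in> verts G" for u
    using that unfolding isolated_vertex_def dominates_delete_verts active_def
    by (auto simp: delete_verts_def dest: adj_in_verts)
  moreover have "v \<in> verts G" "u \<in> verts G" if "v \<rightarrow>\<^bsub>G\<^esub> u" for u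
    using adj_in_verts[OF that] by auto
  ultimately show ?thesis
    unfolding playable_def in_nontrivial_component_iff by blast
qed

section \<open>Effect of a move on the active set\<close>

lemma (in graph) finite_active [simp]: "finite (active G S)"
  using active_subset[of G S] by (rule finite_subset) simp

text \<open>N(S) only grows, so only \<open>v\<close> could become active, by being selected. But
  \<open>v\<close> has an active neighbour outside N(S), so if \<open>v\<close> lies outside N(S) it
  was active already.\<close>

lemma (in graph) active_insert_subset:
  assumes "v \<in> playable G S"
  shows "active G (insert v S) \<subseteq> active G S"
  using assms active_subset[of G S] unfolding playable_iff_active
  by (auto simp: active_def neighborhood_def)

lemma (in graph) card_active_insert_less:
  assumes "v \<in> playable G S"
  shows "card (active G (insert v S)) < card (active G S)"
proof (intro psubset_card_mono psubsetI)
  obtain u where "u \<in> active G S" "v \<rightarrow>\<^bsub>G\<^esub> u" using assms by (auto simp: playable_iff_active)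
  moreover from this have "u \<notin> active G (insert v S)"
    by (auto simp: active_def neighborhood_def)
  ultimately show "active G (insert v S) \<noteq> active G S" by blast
qed (use assms active_insert_subset in auto)

lemma (in graph) card_active_insert_le:
  assumes "v \<in> playable G S" "x \<in> active G S" "y \<in> active G S" "x \<noteq> y"
    and "x \<notin> active G (insert v S)" "y \<notin> active G (insert v S)"
  shows "card (active G (insert v S)) \<le> card (active G S) - 2"
proof -
  have "active G (insert v S) \<subseteq> active G S - {x, y}"
    using active_insert_subset[OF assms(1)] assms(5,6) by blast
  then have "card (active G (insert v S)) \<le> card (active G S - {x, y})"
    by (intro card_mono) auto
  also have "\<dots> = card (active G S) - 2"
    using assms(2-4) by (simp add: card_Diff_subset)
  finally show ?thesis .
qed

section \<open>One-move bounds for the two players\<close>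

lemma remaining_moves_eq_0:
  assumes "playable G S = {}"
  shows "remaining_moves G p S = 0"
  using assms by (cases p) (simp_all add: remaining_moves.simps)

lemma (in graph) remaining_moves_Dominator_le:
  assumes "v \<in> playable G S"
  shows "remaining_moves G Dominator S \<le> 1 + remaining_moves G Staller (insert v S)"
proof -
  have "finite (playable G S)" by (simp add: playable_def)
  then show ?thesis using assms by (subst remaining_moves.simps) auto
qed

lemma (in graph) remaining_moves_Staller_le:
  assumes "\<And>v. v \<in> playable G S \<Longrightarrow> remaining_moves G Dominator (insert v S) \<le> k"
  shows "remaining_moves G Staller S \<le> 1 + k"
proof -
  have "finite (playable G S)" by (simp add: playable_def)
  then show ?thesis using assms by (subst remaining_moves.simps) auto
qed

section \<open>Graphs of order at least 3 and diameter at most 2\<close>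

locale diameter_two_graph = graph +
  assumes card_verts_ge: "3 \<le> card (verts G)"
    and adj_or_common_neighbour:
      "\<lbrakk>u \<in> verts G; v \<in> verts G; u \<noteq> v\<rbrakk> \<Longrightarrow> u \<rightarrow>\<^bsub>G\<^esub> v \<or> (\<exists>w. u \<rightarrow>\<^bsub>G\<^esub> w \<and> w \<rightarrow>\<^bsub>G\<^esub> v)"
begin

lemma ex_other_vertex: "\<exists>z \<in> verts G. z \<noteq> u \<and> z \<noteq> v"
proof (rule ccontr)
  assume "\<not> ?thesis"
  then have "verts G \<subseteq> {u, v}" by blast
  then have "card (verts G) \<le> card {u, v}" by (intro card_mono) auto
  also have "\<dots> \<le> 2" by (simp add: card_insert_if)
  finally show False using card_verts_ge by simp
qed

lemma ex_neighbour:
  assumes "u \<in> verts G"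
  shows "\<exists>w. u \<rightarrow>\<^bsub>G\<^esub> w"
  using ex_other_vertex[of u u] adj_or_common_neighbour[OF assms] by blast

lemma playable_empty_iff: "playable G S = {} \<longleftrightarrow> active G S = {}"
proof -
  have "\<exists>v. v \<rightarrow>\<^bsub>G\<^esub> u" if "u \<in> active G S" for u
    using that active_subset[of G S] ex_neighbour[of u] adj_sym by blast
  moreover have "playable G S = {} \<longleftrightarrow> (\<forall>v. \<forall>u\<in>active G S. \<not> v \<rightarrow>\<^bsub>G\<^esub> u)"
    using playable_iff_active by blast
  ultimately show ?thesis by blast
qed

lemma active_empty: "active G {} = verts G"
proof -
  have "\<exists>w \<in> verts G. u \<rightarrow>\<^bsub>G\<^esub> w" if "u \<in> verts G" for u
    using ex_neighbour[OF that] adj_in_verts by blast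
  then show ?thesis by (auto simp: active_def neighborhood_def)
qed

lemma playable_empty: "playable G {} = verts G"
proof
  show "verts G \<subseteq> playable G {}"
    using ex_neighbour adj_in_verts unfolding playable_iff_active active_empty subset_iff by blast
qed (auto simp: playable_def)

text \<open>A route of length at most 2 from \<open>u\<close> to a third vertex leaves the edge
  either at \<open>u\<close> or, after passing through \<open>w\<close>, at
  \<open>w\<close>.\<close>

lemma ex_edge_leaving:
  assumes "u \<rightarrow>\<^bsub>G\<^esub> w"
  shows "\<exists>z. (u \<rightarrow>\<^bsub>G\<^esub> z \<and> z \<noteq> w) \<or> (w \<rightarrow>\<^bsub>G\<^esub> z \<and> z \<noteq> u)"
proof -
  obtain z where "z \<in> verts G" "z \<noteq> u" "z \<noteq> w" using ex_other_vertex by blast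
  then show ?thesis
    using adj_or_common_neighbour[of u z] adj_in_verts[OF assms] by blast
qed

section \<open>Dominator's double removal and the general bound\<close>

lemma Dominator_removes_two:
  assumes "active G S \<noteq> {}"
  shows "\<exists>v \<in> playable G S. card (active G (insert v S)) \<le> card (active G S) - 2"
proof -
  let ?U = "verts G - neighborhood G S"
  consider (branch) u x y where "u \<in> ?U" "x \<in> ?U" "y \<in> ?U" "x \<noteq> y" "u \<rightarrow>\<^bsub>G\<^esub> x" "u \<rightarrow>\<^bsub>G\<^esub> y"
    | (matching) u w where "u \<in> ?U" "w \<in> ?U" "u \<rightarrow>\<^bsub>G\<^esub> w"
        "\<And>u x y. \<lbrakk>u \<in> ?U; x \<in> ?U; y \<in> ?U; u \<rightarrow>\<^bsub>G\<^esub> x; u \<rightarrow>\<^bsub>G\<^esub> y\<rbrakk> \<Longrightarrow> x = y"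
    | (single) a where "active G S = {a}"
    | (edgeless) x y where "x \<in> active G S" "y \<in> active G S" "x \<noteq> y"
        "\<And>u w. u \<in> ?U \<Longrightarrow> w \<in> ?U \<Longrightarrow> \<not> u \<rightarrow>\<^bsub>G\<^esub> w"
  proof (cases "\<exists>u\<in>?U. \<exists>w\<in>?U. u \<rightarrow>\<^bsub>G\<^esub> w")
    case True
    then show ?thesis using branch matching by blast
  next
    case False
    then show ?thesis using edgeless single is_singletonI'[OF assms] is_singletonE by metis
  qed
  then show ?thesis
  proof cases
    case branch
    have "x \<in> active G S" "y \<in> active G S"
      using branch adj_sym by (auto simp: active_def)
    moreover have "x \<notin> active G (insert u S)" "y \<notin> active G (insert u S)"
      using branch by (auto simp: active_def neighborhood_def)
    moreover have "u \<in> playable G S" using calculation branch playable_iff_active by blast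
    ultimately show ?thesis using card_active_insert_le branch(4) by blast
  next
    case matching
    note uniq = matching(4)
    have *: ?thesis if "u \<in> ?U" "w \<in> ?U" "u \<rightarrow>\<^bsub>G\<^esub> w" "u \<rightarrow>\<^bsub>G\<^esub> z" "z \<noteq> w" for u w z
    proof -
      have act: "u \<in> active G S" "w \<in> active G S"
        using that adj_sym by (auto simp: active_def)
      have zu: "z \<rightarrow>\<^bsub>G\<^esub> u" and wu: "w \<rightarrow>\<^bsub>G\<^esub> u" using that adj_sym by auto
      have "z \<in> playable G S" using act zu playable_iff_active by blast
      moreover have "u \<notin> active G (insert z S)"
        using that(1) zu by (auto simp: active_def neighborhood_def)
      \<comment> \<open>Unselected, \<open>w\<close> could stay active only through a neighbour
        outside N(S); its only one is \<open>u\<close>, which \<open>z\<close> now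
        dominates.\<close>
      moreover have "w \<notin> insert z S"
        using that wu by (auto simp: neighborhood_def)
      then have "w \<notin> active G (insert z S)"
        using uniq[OF that(2) _ that(1) _ wu] zu adj_in_verts[OF zu]
        by (auto simp: active_def neighborhood_def)
      moreover have "u \<noteq> w" using that(3) adj_not_same by blast
      ultimately show ?thesis using act card_active_insert_le by blast
    qed
    \<comment> \<open>The edge leaving may start at either end, so \<open>*\<close> is applied to
      \<open>u\<close>, \<open>w\<close> in one of the two orders.\<close>
    from ex_edge_leaving[OF matching(3)] show ?thesis
      using * matching(1-3) adj_sym by blast
  next
    case single
    then obtain v where v: "v \<in> playable G S" using playable_empty_iff[of S] by blast
    \<comment> \<open>Truncated subtraction: the bound is 1 - 2 = 0.\<close>
    then have "card (active G (insert v S)) \<le> card (active G S) - 2"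
      using card_active_insert_less[OF v] single by simp
    with v show ?thesis by blast
  next
    case edgeless
    then have "x \<in> ?U" "y \<in> ?U" using active_subset[of G S] by blast+
    then obtain t where "x \<rightarrow>\<^bsub>G\<^esub> t" "t \<rightarrow>\<^bsub>G\<^esub> y"
      using edgeless adj_or_common_neighbour[of x y] by blast
    then have t: "t \<rightarrow>\<^bsub>G\<^esub> x" "t \<rightarrow>\<^bsub>G\<^esub> y" using adj_sym by auto
    then have "x \<notin> active G (insert t S)" "y \<notin> active G (insert t S)"
      by (auto simp: active_def neighborhood_def)
    moreover have "t \<in> playable G S" using edgeless t playable_iff_active by blast
    ultimately show ?thesis using card_active_insert_le edgeless by blast
  qed
qed

text \<open>Joint induction: one move plus Staller's bound at m - 2 gives (2m + 1)/3, and one move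
  plus Dominator's bound at m - 1 gives (2m + 2)/3.\<close>

lemma remaining_moves_le:
  "3 * remaining_moves G Dominator S \<le> 2 * card (active G S) + 1"
  "3 * remaining_moves G Staller S \<le> 2 * card (active G S) + 2"
proof (induction "card (active G S)" arbitrary: S rule: less_induct)
  case less
  show "3 * remaining_moves G Dominator S \<le> 2 * card (active G S) + 1"
  proof (cases "active G S = {}")
    case True
    then show ?thesis by (simp add: remaining_moves_eq_0 playable_empty_iff)
  next
    case False
    then obtain v where v: "v \<in> playable G S"
      and le: "card (active G (insert v S)) \<le> card (active G S) - 2"
      using Dominator_removes_two by blast
    have step: "remaining_moves G Dominator S \<le> 1 + remaining_moves G Staller (insert v S)"
      by (rule remaining_moves_Dominator_le[OF v])
    have pos: "0 < card (active G S)" using False by (simp add: card_gt_0_iff)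
    show ?thesis
    \<comment> \<open>If the game ends here, one move was made and m \<ge> 1 suffices; Staller's
      bound would be too weak for m = 1. Otherwise m \<ge> 3 and the subtraction of 2 is not
      truncated.\<close>
    proof (cases "active G (insert v S) = {}")
      case True
      then have "remaining_moves G Staller (insert v S) = 0"
        by (simp add: remaining_moves_eq_0 playable_empty_iff)
      then show ?thesis using step pos by simp
    next
      case False
      then have "0 < card (active G (insert v S))" by (simp add: card_gt_0_iff)
      then show ?thesis
        using step le less(2)[OF card_active_insert_less[OF v]] by linarith
    qed
  qed
  show "3 * remaining_moves G Staller S \<le> 2 * card (active G S) + 2"
  proof (cases "active G S = {}")
    case True
    then show ?thesis by (simp add: remaining_moves_eq_0 playable_empty_iff)
  next
    case False
    have "remaining_moves G Dominator (insert v S) \<le> (2 * card (active G S) - 1) div 3"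
      if "v \<in> playable G S" for v
      using less(1)[OF card_active_insert_less[OF that]] card_active_insert_less[OF that]
      by linarith
    from remaining_moves_Staller_le[OF this]
    have "remaining_moves G Staller S \<le> 1 + (2 * card (active G S) - 1) div 3" .
    moreover have "0 < card (active G S)" using False by (simp add: card_gt_0_iff)
    ultimately show ?thesis by linarith
  qed
qed

section \<open>The first move\<close>

lemma pendant_vertex_dominating_neighbour:
  assumes "v \<in> verts G" "v \<rightarrow>\<^bsub>G\<^esub> c" "\<And>d. v \<rightarrow>\<^bsub>G\<^esub> d \<Longrightarrow> d = c" "z \<in> verts G" "z \<noteq> c"
  shows "c \<rightarrow>\<^bsub>G\<^esub> z"
proof (cases "z = v")
  case True
  then show ?thesis using assms(2) adj_sym by blast
next
  case False
  \<comment> \<open>Every route from \<open>v\<close> starts through its only neighbour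
    \<open>c\<close>.\<close>
  then show ?thesis using adj_or_common_neighbour[OF assms(1,4)] assms(3,5) by blast
qed

lemma card_active_singleton_le:
  "card (active G {v}) \<le> card (verts G) - card (neighborhood G {v})"
proof -
  have "card (active G {v}) \<le> card (verts G - neighborhood G {v})"
    using active_subset[of G "{v}"] by (intro card_mono) auto
  also have "\<dots> = card (verts G) - card (neighborhood G {v})"
    by (rule card_Diff_subset) (auto simp: neighborhood_def)
  finally show ?thesis .
qed

text \<open>If Staller opens at a vertex of degree at least 2, at most n - 2 vertices stay active
  and Dominator's bound is (2n - 3)/3. If she opens at a pendant vertex, Dominator ends the game by
  playing its neighbour.\<close>

lemma S_game_le: "3 * remaining_moves G Staller {} \<le> 2 * card (verts G)"
proof -
  have "remaining_moves G Dominator {v} \<le> (2 * card (verts G) - 3) div 3"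
    if v: "v \<in> verts G" for v
  proof (cases "\<exists>c d. v \<rightarrow>\<^bsub>G\<^esub> c \<and> v \<rightarrow>\<^bsub>G\<^esub> d \<and> c \<noteq> d")
    case True
    then obtain c d where "v \<rightarrow>\<^bsub>G\<^esub> c" "v \<rightarrow>\<^bsub>G\<^esub> d" "c \<noteq> d" by blast
    then have "{c, d} \<subseteq> neighborhood G {v}"
      by (auto simp: neighborhood_def dest: adj_in_verts)
    moreover have "finite (neighborhood G {v})" by (simp add: neighborhood_def)
    ultimately have "2 \<le> card (neighborhood G {v})"
      using card_mono[of "neighborhood G {v}" "{c, d}"] \<open>c \<noteq> d\<close> by simp
    then show ?thesis
      using card_active_singleton_le[of v] remaining_moves_le(1)[of "{v}"] card_verts_ge
      by linarith
  next
    case False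
    obtain c where c: "v \<rightarrow>\<^bsub>G\<^esub> c" using ex_neighbour v by blast
    have "v \<in> active G {v}" using v adj_not_same by (auto simp: active_def neighborhood_def)
    then have play: "c \<in> playable G {v}" using c adj_sym playable_iff_active by blast
    have "d = c" if "v \<rightarrow>\<^bsub>G\<^esub> d" for d using that c False by blast
    note dom = pendant_vertex_dominating_neighbour[OF v c this]
    \<comment> \<open>\<open>c\<close> dominates every other vertex and \<open>v\<close> dominates
      \<open>c\<close>.\<close>
    have "verts G - neighborhood G {c, v} = {}"
      using dom c unfolding neighborhood_def by blast
    then have "active G {c, v} = {}" using active_subset[of G "{c, v}"] by blast
    then have "remaining_moves G Staller {c, v} = 0"
      by (simp add: remaining_moves_eq_0 playable_empty_iff)
    then have "remaining_moves G Dominator {v} \<le> 1"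
      using remaining_moves_Dominator_le[OF play] by simp
    then show ?thesis using card_verts_ge by linarith
  qed
  then have "remaining_moves G Staller {} \<le> 1 + (2 * card (verts G) - 3) div 3"
    by (intro remaining_moves_Staller_le) (simp add: playable_empty)
  then show ?thesis using card_verts_ge by linarith
qed

text \<open>The exception is the 5-cycle.\<close>

lemma Dominator_first_removes_three:
  assumes "4 \<le> card (verts G)" "card (verts G) \<noteq> 5"
  shows "\<exists>v \<in> verts G. card (active G {v}) \<le> card (verts G) - 3"
proof (cases "\<exists>v \<in> verts G. 3 \<le> card (neighborhood G {v})")
  case True
  then obtain v where "v \<in> verts G" "3 \<le> card (neighborhood G {v})" by blast
  then show ?thesis using card_active_singleton_le[of v] by (intro bexI[of _ v]) auto
next
  case False
  let ?N = "\<lambda>v. neighborhood G {v}"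
  have fin: "finite (?N v)" for v by (simp add: neighborhood_def)
  have mem: "w \<in> ?N v \<longleftrightarrow> v \<rightarrow>\<^bsub>G\<^esub> w" for v w
    by (auto simp: neighborhood_def dest: adj_in_verts)
  have deg: "card (?N v) \<le> 2" if "v \<in> verts G" for v
    using False that by fastforce
  obtain v where v: "v \<in> verts G" using ex_other_vertex by blast
  \<comment> \<open>One of the at most two neighbours of \<open>w\<close> is \<open>v\<close>
    itself.\<close>
  have one: "card (?N w - {v}) \<le> 1" if "w \<in> ?N v" for w
    using that deg[of w] adj_sym[of v w] adj_in_verts[of v w] mem
    by (subst card_Diff_singleton) auto
  \<comment> \<open>The vertices other than \<open>v\<close> reached by a second step from
    \<open>v\<close>.\<close>
  define B where "B = (\<Union>w\<in>?N v. ?N w - {v})"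
  have "card B \<le> (\<Sum>w\<in>?N v. card (?N w - {v}))"
    unfolding B_def by (rule card_UN_le[OF fin])
  also have "\<dots> \<le> card (?N v) * 1"
    using sum_bounded_above[of "?N v" "\<lambda>w. card (?N w - {v})" 1] one by simp
  finally have "card B \<le> card (?N v)" by simp
  moreover have "verts G \<subseteq> insert v (?N v \<union> B)"
  proof
    fix x assume "x \<in> verts G"
    then consider "x = v" | "v \<rightarrow>\<^bsub>G\<^esub> x" | w where "x \<noteq> v" "v \<rightarrow>\<^bsub>G\<^esub> w" "w \<rightarrow>\<^bsub>G\<^esub> x"
      using adj_or_common_neighbour[OF v] by blast
    then show "x \<in> insert v (?N v \<union> B)"
      unfolding B_def by cases (use mem in blast)+
  qed
  then have "card (verts G) \<le> card (insert v (?N v \<union> B))"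
    using fin by (intro card_mono) (auto simp: B_def)
  moreover have "card (insert v (?N v \<union> B)) \<le> Suc (card (?N v \<union> B))"
    by (rule card_insert_le_m1) auto
  moreover have "card (?N v \<union> B) \<le> card (?N v) + card B" by (rule card_Un_le)
  \<comment> \<open>Maximum degree 2 gives n \<le> 1 + 2 + 2 = 5, and 5 is excluded.\<close>
  ultimately have four: "card (verts G) = 4" using deg[OF v] assms by linarith
  \<comment> \<open>If \<open>v\<close> were pendant, its neighbour would have degree 3.\<close>
  have two: "card (?N v) = 2"
  proof (rule ccontr)
    assume "card (?N v) \<noteq> 2"
    obtain c where c: "v \<rightarrow>\<^bsub>G\<^esub> c" using ex_neighbour v by blast
    then have "0 < card (?N v)" using mem fin by (auto simp: card_gt_0_iff)
    then have "card (?N v) = 1" using \<open>card (?N v) \<noteq> 2\<close> deg[OF v] by linarith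
    then have "d = c" if "v \<rightarrow>\<^bsub>G\<^esub> d" for d
      using that c mem by (metis card_1_singletonE singletonD)
    from pendant_vertex_dominating_neighbour[OF v c this]
    have "verts G - {c} \<subseteq> ?N c" using mem by blast
    then have "card (verts G - {c}) \<le> card (?N c)" by (intro card_mono fin)
    then show False using four deg[of c] adj_in_verts[OF c] by simp
  qed
  have vN: "v \<notin> ?N v" using mem adj_not_same by blast
  have "card (verts G - ?N v) = 2"
    using four two fin by (subst card_Diff_subset) (auto simp: neighborhood_def)
  then obtain a b where ab: "verts G - ?N v = {a, b}"
    by (auto simp: card_2_iff)
  \<comment> \<open>Only \<open>v\<close> and one vertex not adjacent to it lie outside N(v); the
    latter is unselected and has no neighbour there.\<close>
  have "active G {v} \<subseteq> {v}"
  proof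
    fix x assume x: "x \<in> active G {v}"
    show "x \<in> {v}"
    proof (rule ccontr)
      assume "x \<notin> {v}"
      then obtain w where w: "w \<in> verts G - ?N v" "x \<rightarrow>\<^bsub>G\<^esub> w" "x \<in> verts G - ?N v"
        using x by (auto simp: active_def)
      then have "w \<noteq> v" "w \<noteq> x" using mem adj_sym adj_not_same by blast+
      moreover have "v \<in> verts G - ?N v" using v vN by blast
      ultimately show False using w \<open>x \<notin> {v}\<close> ab by auto
    qed
  qed
  then have "card (active G {v}) \<le> 1" using card_mono[of "{v}"] by fastforce
  then show ?thesis using four v by auto
qed

lemma D_game_le: "3 * remaining_moves G Dominator {} \<le> 2 * card (verts G)"
proof (cases "card (verts G) = 3 \<or> card (verts G) = 5")
  case True
  \<comment> \<open>For n = 3 and n = 5, rounding (2n + 1)/3 down already gives at most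
    2n/3.\<close>
  then show ?thesis using remaining_moves_le(1)[of "{}"] unfolding active_empty by presburger
next
  case False
  then obtain v where v: "v \<in> verts G" "card (active G {v}) \<le> card (verts G) - 3"
    using Dominator_first_removes_three card_verts_ge by fastforce
  have "remaining_moves G Dominator {} \<le> 1 + remaining_moves G Staller {v}"
    using remaining_moves_Dominator_le[of v "{}"] v by (simp add: playable_empty)
  \<comment> \<open>1 + (2(n - 3) + 2)/3 = (2n - 1)/3.\<close>
  then show ?thesis
    using remaining_moves_le(2)[of "{v}"] v(2) card_verts_ge by linarith
qed

end

section \<open>From the distance function to common neighbours\<close>

lemma (in graph) diameter_le_2_imp:
  assumes "diameter G \<le> 2" "u \<in> verts G" "v \<in> verts G" "u \<noteq> v"
  shows "u \<rightarrow>\<^bsub>G\<^esub> v \<or> (\<exists>w. u \<rightarrow>\<^bsub>G\<^esub> w \<and> w \<rightarrow>\<^bsub>G\<^esub> v)"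
proof -
  have "\<mu> (\<lambda>_. 1) u v \<le> diameter G"
    unfolding diameter_def
    by (rule SUP_upper2[OF assms(2)], rule SUP_upper[OF assms(3)])
  also have "\<dots> \<le> 2" by (rule assms(1))
  \<comment> \<open>A strict bound on the infimum \<open>\<mu>\<close> yields an actual walk of cost
    below 3; with unit weights the cost is the length.\<close>
  also have "(2 :: ereal) < ereal 3" by simp
  finally have "\<mu> (\<lambda>_. 1) u v < ereal 3" .
  then obtain p where p: "awalk u p v" "awalk_cost (\<lambda>_. 1) p < 3"
    by (auto simp: \<mu>_def INF_less_iff)
  have "length p < 3" using p(2) by (simp add: awalk_cost_def sum_list_triv)
  then consider "p = []" | a where "p = [a]" | a b where "p = [a, b]"
    by (auto simp: numeral_3_eq_3 less_Suc_eq_le le_Suc_eq length_Suc_conv)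
  then show ?thesis
    using p(1) assms(4) by cases (auto simp: awalk_Cons_iff awalk_Nil_iff arcs_ends_conv image_iff)
qed

theorem theorem3p6:
  fixes G :: "('a, 'b) pre_digraph" and n :: nat
  assumes "graph G"
    and "connected G"
    and "card (verts G) = n"
    and "n \<ge> 3"
    and "diameter G \<le> 2"
  shows "real (D_game_total_isolation_number G) \<le> 2 / 3 * real n \<and>
         real (S_game_total_isolation_number G) \<le> 2 / 3 * real n"
proof -
  interpret graph G by fact
  interpret diameter_two_graph G
    by unfold_locales (use assms diameter_le_2_imp in auto)
  show ?thesis
    using D_game_le S_game_le assms(3)
    by (simp add: D_game_total_isolation_number_def S_game_total_isolation_number_def)
qed

end
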